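(* Let $(\xi_n)_{n\in\mathbb{N}}$ be a sequence of independent identically distributed Bernoulli random variables satisfying $\Pr(\xi_n=1)=\Pr(\xi_n=0)=1/2$ for each $n\in\mathbb{N}$, and let $\mathcal{C}=\{n\in\mathbb{N} : \xi_n=1\}$. Then, with probability $1$, there exist infinite sets $\mathcal{A},\mathcal{B}\subset\mathbb{N}$ such that $\mathcal{A}+\mathcal{B}\subset\mathcal{C}$.
   Context: For sets of integers $\mathcal{A},\mathcal{B}$, $\mathcal{A}+\mathcal{B}=\{a+b : (a,b)\in\mathcal{A}\times\mathcal{B}\}$. *)

theory Defs
  imports "HOL-Probability.Probability" "HOL-Library.Set_Algebras"
begin

end

theory Submission
  imports Defs
begin

text \<open>
  Almost surely \<open>C = {n. \<xi> n \<omega> = 1}\<close> contains arbitrarily long runs of consecutive integers,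
  arbitrarily far out (\<open>AE_arbitrarily_long_runs\<close>), and this alone yields \<open>A\<close> and \<open>B\<close>.

  Indeed, choose \<open>x 0 < x 1 < \<dots>\<close> so that \<open>C\<close> contains the whole run from
  \<open>x (Suc k)\<close> to \<open>x (Suc k) + x k\<close>. For \<open>i < j\<close> we have \<open>x i \<le> x (j - 1)\<close>, hence \<open>x j + x i\<close>
  lies in the run that starts at \<open>x j\<close>. All sums of two terms with distinct indices are thus in
  \<open>C\<close>, and the even-indexed and the odd-indexed terms can serve as \<open>A\<close> and \<open>B\<close>
  (\<open>infinite_sumset_in_thick_set\<close>).

  For the probabilistic part, cut \<open>\<nat>\<close> into consecutive blocks of a fixed length \<open>L\<close>. The events
  that a block lies in \<open>C\<close> are independent, each of probability \<open>(1/2) ^ L\<close>, so infinitely many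
  of them occur almost surely. A countable intersection over \<open>L\<close> finishes the argument.
\<close>

text \<open>
  Sets with this hypothesis are known as thick. The interval \<open>{x (Suc k)..x (Suc k) + x k}\<close>
  absorbs the sums with all earlier terms at once, so that each choice depends on the preceding
  term only.
\<close>

lemma infinite_sumset_in_thick_set:
  fixes C :: "nat set"
  assumes thick: "\<And>N L. \<exists>n\<ge>N. {n..n + L} \<subseteq> C"
  shows "\<exists>A B. infinite A \<and> infinite B \<and> A + B \<subseteq> C"
proof -
  have "\<exists>y>x. {y..y + x} \<subseteq> C" for x
    using thick[of "Suc x" x] by (simp add: Suc_le_eq)
  then have "\<exists>x. \<forall>k. True \<and> x k < x (Suc k) \<and> {x (Suc k)..x (Suc k) + x k} \<subseteq> C"
    by (intro dependent_nat_choice) simp_all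
  then obtain x where step: "\<And>k. x k < x (Suc k)" "\<And>k. {x (Suc k)..x (Suc k) + x k} \<subseteq> C"
    by blast
  from step(1) have mono: "strict_mono x"
    by (simp add: strict_mono_Suc_iff)
  have later_plus_earlier: "x j + x i \<in> C" if "i < j" for i j
  proof -
    obtain k where j: "j = Suc k" and "i \<le> k"
      using \<open>i < j\<close> by (cases j) auto
    have "x i \<le> x k"
      using mono \<open>i \<le> k\<close> by (simp add: strict_mono_less_eq)
    then show ?thesis
      using step(2)[of k] j by auto
  qed
  then have distinct: "x i + x j \<in> C" if "i \<noteq> j" for i j
    using that by (metis add.commute nat_neq_iff)
  define A B where "A = range (\<lambda>k. x (2 * k))" and "B = range (\<lambda>k. x (2 * k + 1))"
  have "inj (\<lambda>k. x (2 * k))" "inj (\<lambda>k. x (2 * k + 1))"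
    using mono by (simp_all add: inj_def strict_mono_eq)
  then have "infinite A" "infinite B"
    unfolding A_def B_def by (simp_all add: range_inj_infinite)
  moreover have "A + B \<subseteq> C"
  proof
    fix c assume "c \<in> A + B"
    then obtain k l where c: "c = x (2 * k) + x (2 * l + 1)"
      by (auto simp: A_def B_def elim!: set_plus_elim)
    have "2 * k \<noteq> 2 * l + 1"
      by presburger
    then show "c \<in> C"
      unfolding c by (rule distinct)
  qed
  ultimately show ?thesis
    by blast
qed

text \<open>
  The product formula for finitely many of the new events unfolds into the one for the union of
  their index sets; nonempty index sets are required because an intersection over the empty set
  is \<open>UNIV\<close>, which need not be an event.
\<close>

lemma (in prob_space) indep_events_Inter_disjoint:
  assumes indep: "indep_events F I"
    and K: "\<And>j. j \<in> J \<Longrightarrow> K j \<subseteq> I" "\<And>j. j \<in> J \<Longrightarrow> finite (K j)" "\<And>j. j \<in> J \<Longrightarrow> K j \<noteq> {}"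
    and disj: "disjoint_family_on K J"
  shows "indep_events (\<lambda>j. \<Inter>i\<in>K j. F i) J"
proof (rule indep_eventsI)
  have events: "F i \<in> events" if "i \<in> I" for i
    using indep that by (auto simp: indep_events_def)
  have prob_Inter: "prob (\<Inter>i\<in>S. F i) = (\<Prod>i\<in>S. prob (F i))"
    if "S \<subseteq> I" "finite S" "S \<noteq> {}" for S
    using indep that by (auto simp: indep_events_def)
  show "(\<Inter>i\<in>K j. F i) \<in> events" if "j \<in> J" for j
    using K[OF that] events by (intro sets.finite_INT) auto
  fix S assume S: "S \<subseteq> J" "finite S" "S \<noteq> {}"
  have "prob (\<Inter>j\<in>S. \<Inter>i\<in>K j. F i) = prob (\<Inter>i\<in>(\<Union>j\<in>S. K j). F i)"
    by (rule arg_cong[where f = prob]) auto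
  also have "\<dots> = (\<Prod>i\<in>(\<Union>j\<in>S. K j). prob (F i))"
  proof (rule prob_Inter)
    show "(\<Union>j\<in>S. K j) \<subseteq> I" "finite (\<Union>j\<in>S. K j)"
      using S K(1,2) by auto
    show "(\<Union>j\<in>S. K j) \<noteq> {}"
      using S K(3) by auto
  qed
  also have "\<dots> = (\<Prod>j\<in>S. \<Prod>i\<in>K j. prob (F i))"
  proof (rule prod.UNION_disjoint)
    show "\<forall>j\<in>S. finite (K j)"
      using S(1) K(2) by auto
    show "\<forall>i\<in>S. \<forall>j\<in>S. i \<noteq> j \<longrightarrow> K i \<inter> K j = {}"
      using disjoint_family_onD[OF disj] S(1) by (meson subsetD)
  qed (rule S(2))
  also have "\<dots> = (\<Prod>j\<in>S. prob (\<Inter>i\<in>K j. F i))"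
    using S(1) K by (intro prod.cong refl prob_Inter[symmetric]) auto
  finally show "prob (\<Inter>j\<in>S. \<Inter>i\<in>K j. F i) = (\<Prod>j\<in>S. prob (\<Inter>i\<in>K j. F i))" .
qed

text \<open>
  By Borel's zero-one law the limsup has probability 0 or 1. It is the limit of the decreasing
  unions \<open>\<Union>m\<ge>n. E m\<close>, each of probability at least \<open>p\<close>, so the value 0 is excluded.
\<close>

lemma (in prob_space) AE_infinite_of_indep_events:
  fixes E :: "nat \<Rightarrow> 'a set"
  assumes indep: "indep_events E UNIV" and "0 < p" and lower: "\<And>m. p \<le> prob (E m)"
  shows "AE \<omega> in M. infinite {m. \<omega> \<in> E m}"
proof -
  have [measurable]: "E m \<in> events" for m
    using indep by (auto simp: indep_events_def)
  let ?U = "\<lambda>n. \<Union>m\<in>{n..}. E m"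
  have "(\<lambda>n. prob (?U n)) \<longlonglongrightarrow> prob (\<Inter>n. ?U n)"
    by (intro finite_Lim_measure_decseq) (auto simp: decseq_def intro: order_trans)
  moreover have "p \<le> prob (?U n)" for n
  proof -
    have "p \<le> prob (E n)"
      by (rule lower)
    also have "\<dots> \<le> prob (?U n)"
      by (intro finite_measure_mono) auto
    finally show ?thesis .
  qed
  ultimately have "p \<le> prob (\<Inter>n. ?U n)"
    by (intro LIMSEQ_le_const) auto
  with \<open>0 < p\<close> have "prob (\<Inter>n. ?U n) = 1"
    using borel_0_1_law[OF indep] by auto
  then have "AE \<omega> in M. \<omega> \<in> (\<Inter>n. ?U n)"
    by (subst (asm) prob_eq_1) auto
  then show ?thesis
    by eventually_elim (auto simp: infinite_nat_iff_unbounded_le)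
qed

text \<open>
  Runs that start at neighbouring positions share events and are dependent. Runs along disjoint
  blocks are independent, and each has probability at least \<open>p ^ Suc L\<close>; as this bound is the
  same for all blocks, infinitely many blocks occur.
\<close>

lemma (in prob_space) AE_arbitrarily_long_runs:
  fixes F :: "nat \<Rightarrow> 'a set"
  assumes indep: "indep_events F UNIV" and "0 < p" and lower: "\<And>n. p \<le> prob (F n)"
  shows "AE \<omega> in M. \<forall>N L. \<exists>n\<ge>N. {n..n + L} \<subseteq> {n. \<omega> \<in> F n}"
proof -
  have "AE \<omega> in M. \<forall>N. \<exists>n\<ge>N. {n..n + L} \<subseteq> {n. \<omega> \<in> F n}" for L
  proof -
    define K where "K m = {m * Suc L..m * Suc L + L}" for m
    define E where "E m = (\<Inter>i\<in>K m. F i)" for m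
    have "i div Suc L = m" if "i \<in> K m" for i m
      using that by (intro div_nat_eqI) (auto simp: K_def mult.commute)
    then have "disjoint_family K"
      unfolding disjoint_family_on_def by blast
    then have indep_E: "indep_events E UNIV"
      unfolding E_def
      by (intro indep_events_Inter_disjoint[OF indep]) (simp_all, simp_all add: K_def)
    have "p ^ Suc L \<le> prob (E m)" for m
    proof -
      have "p ^ Suc L = (\<Prod>i\<in>K m. p)"
        by (simp add: K_def)
      also have "\<dots> \<le> (\<Prod>i\<in>K m. prob (F i))"
        using \<open>0 < p\<close> lower by (intro prod_mono) (auto intro: less_imp_le)
      also have "\<dots> = prob (E m)"
        using indep by (auto simp: indep_events_def E_def K_def)
      finally show ?thesis .
    qed
    with indep_E \<open>0 < p\<close> have "AE \<omega> in M. infinite {m. \<omega> \<in> E m}"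
      by (intro AE_infinite_of_indep_events[where p = "p ^ Suc L"]) auto
    then show ?thesis
    proof eventually_elim
      case (elim \<omega>)
      show ?case
      proof
        fix N
        obtain m where "N \<le> m" and m: "\<omega> \<in> E m"
          using elim by (auto simp: infinite_nat_iff_unbounded_le)
        have "N \<le> m * Suc L"
          using \<open>N \<le> m\<close> by (simp add: trans_le_add1)
        moreover have "{m * Suc L..m * Suc L + L} \<subseteq> {n. \<omega> \<in> F n}"
          using m by (auto simp: E_def K_def)
        ultimately show "\<exists>n\<ge>N. {n..n + L} \<subseteq> {n. \<omega> \<in> F n}"
          by blast
      qed
    qed
  qed
  then have "AE \<omega> in M. \<forall>L N. \<exists>n\<ge>N. {n..n + L} \<subseteq> {n. \<omega> \<in> F n}"
    by (simp add: AE_all_countable)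
  then show ?thesis
    by eventually_elim blast
qed

theorem theorem2:
  fixes M :: "'w measure" and \<xi> :: "nat \<Rightarrow> 'w \<Rightarrow> real"
  assumes "prob_space M"
    and "prob_space.indep_vars M (\<lambda>_. borel) \<xi> UNIV"
    and "\<And>n. measure M {\<omega> \<in> space M. \<xi> n \<omega> = 1} = 1 / 2"
    and "\<And>n. measure M {\<omega> \<in> space M. \<xi> n \<omega> = 0} = 1 / 2"
  shows "AE \<omega> in M. \<exists>A B :: nat set. infinite A \<and> infinite B \<and> A + B \<subseteq> {n. \<xi> n \<omega> = 1}"
proof -
  interpret prob_space M by fact
  define F where "F n = {\<omega> \<in> space M. \<xi> n \<omega> = 1}" for n
  have "indep_events F UNIV"
    unfolding F_def using assms(2)
    by (rule indep_eventsI_indep_vars[where P = "\<lambda>_ y. y = 1"]) auto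
  then have "AE \<omega> in M. \<forall>N L. \<exists>n\<ge>N. {n..n + L} \<subseteq> {n. \<omega> \<in> F n}"
    by (rule AE_arbitrarily_long_runs[where p = "1 / 2"]) (auto simp: F_def assms(3))
  then show ?thesis
  proof eventually_elim
    case (elim \<omega>)
    have "{n. \<omega> \<in> F n} \<subseteq> {n. \<xi> n \<omega> = 1}"
      by (auto simp: F_def)
    with elim have "\<exists>n\<ge>N. {n..n + L} \<subseteq> {n. \<xi> n \<omega> = 1}" for N L
      by (meson order_trans)
    then show ?case
      by (rule infinite_sumset_in_thick_set)
  qed
qed

end
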